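(* Let $R$ be an associative ring with identity $1\neq 0$. Suppose that $R$ is a Bezout ring of stable range $1$ with the Kazimirsky condition. Then $R$ is an elementary divisor ring if and only if $R$ is a duo ring.
   Context: Rings are associative with identity $1\neq 0$ and not assumed commutative. $R$ is a Bezout ring if every finitely generated right ideal and every finitely generated left ideal of $R$ is principal. $R$ is a ring of stable range $1$ if for any $a,b\in R$ with $aR+bR=R$ there exists $t\in R$ such that $(a+bt)R=R$. $R$ satisfies the right Kazimirsky condition if $uaR\subseteq aR$ for every $a\in R$ and every invertible $u\in R$; it satisfies the left Kazimirsky condition if $Rau\subseteq Ra$ for every $a\in R$ and every invertible $u\in R$. $R$ satisfies the Kazimirsky condition if it satisfies both the right and the left Kazimirsky conditions. $R$ is an elementary divisor ring if for every (rectangular) matrix $A$ over $R$ there exist invertible matrices $P$ and $Q$ over $R$ of suitable sizes such that $PAQ=D$ is a diagonal matrix (of the same size as $A$, with zero entries off the main diagonal) with diagonal entries $d_1,d_2,\dots$ satisfying $Rd_{i+1}R\subseteq Rd_i\cap d_iR$ for each $i$, where $RdR$ denotes the two-sided ideal generated by $d$. $R$ is a duo ring if every right ideal and every left ideal of $R$ is two-sided; equivalently, $aR=Ra$ for all $a\in R$. *)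

theory Defs
  imports "HOL.Hull" "HOL-Library.Set_Algebras" "Jordan_Normal_Form.Matrix"
begin

text \<open>
  A ring is a type of class \<^class>\<open>ring_1\<close>: associative, with identity \<open>1 \<noteq> 0\<close>, not assumed
  commutative. Properties of the ring as a whole take the type as an \<open>itself\<close> argument.
\<close>

definition right_ideal :: "'a::ring_1 set \<Rightarrow> bool" where
  "right_ideal I \<longleftrightarrow> 0 \<in> I \<and> (\<forall>x\<in>I. \<forall>y\<in>I. x - y \<in> I) \<and> (\<forall>x\<in>I. \<forall>r. x * r \<in> I)"

definition left_ideal :: "'a::ring_1 set \<Rightarrow> bool" where
  "left_ideal I \<longleftrightarrow> 0 \<in> I \<and> (\<forall>x\<in>I. \<forall>y\<in>I. x - y \<in> I) \<and> (\<forall>x\<in>I. \<forall>r. r * x \<in> I)"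

definition two_sided_ideal :: "'a::ring_1 set \<Rightarrow> bool" where
  "two_sided_ideal I \<longleftrightarrow> right_ideal I \<and> left_ideal I"

text \<open>The sets \<open>aR\<close> and \<open>Ra\<close>.\<close>

definition right_multiples :: "'a::ring_1 \<Rightarrow> 'a set" where
  "right_multiples a = {a * r | r. True}"

definition left_multiples :: "'a::ring_1 \<Rightarrow> 'a set" where
  "left_multiples a = {r * a | r. True}"

text \<open>
  \<open>P hull S\<close> is the intersection of all sets satisfying \<open>P\<close> that contain \<open>S\<close>, so it yields the
  right, left or two-sided ideal generated by \<open>S\<close>.
\<close>

definition bezout_ring :: "'a::ring_1 itself \<Rightarrow> bool" where
  "bezout_ring (_ :: 'a itself) \<longleftrightarrow>
     (\<forall>S :: 'a set. finite S \<longrightarrow> (\<exists>d. right_ideal hull S = right_multiples d)) \<and>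
     (\<forall>S :: 'a set. finite S \<longrightarrow> (\<exists>d. left_ideal hull S = left_multiples d))"

definition stable_range_1 :: "'a::ring_1 itself \<Rightarrow> bool" where
  "stable_range_1 (_ :: 'a itself) \<longleftrightarrow>
     (\<forall>a b :: 'a. right_multiples a + right_multiples b = UNIV \<longrightarrow>
        (\<exists>t. right_multiples (a + b * t) = UNIV))"

definition invertible_elem :: "'a::ring_1 \<Rightarrow> bool" where
  "invertible_elem u \<longleftrightarrow> (\<exists>v. u * v = 1 \<and> v * u = 1)"

definition right_kazimirsky :: "'a::ring_1 itself \<Rightarrow> bool" where
  "right_kazimirsky (_ :: 'a itself) \<longleftrightarrow>
     (\<forall>a u :: 'a. invertible_elem u \<longrightarrow> (*) u ` right_multiples a \<subseteq> right_multiples a)"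

definition left_kazimirsky :: "'a::ring_1 itself \<Rightarrow> bool" where
  "left_kazimirsky (_ :: 'a itself) \<longleftrightarrow>
     (\<forall>a u :: 'a. invertible_elem u \<longrightarrow> (\<lambda>x. x * u) ` left_multiples a \<subseteq> left_multiples a)"

definition kazimirsky :: "'a::ring_1 itself \<Rightarrow> bool" where
  "kazimirsky R \<longleftrightarrow> right_kazimirsky R \<and> left_kazimirsky R"

definition elementary_divisor_ring :: "'a::ring_1 itself \<Rightarrow> bool" where
  "elementary_divisor_ring (_ :: 'a itself) \<longleftrightarrow>
     (\<forall>m n. \<forall>A \<in> carrier_mat m n :: 'a mat set.
        \<exists>P \<in> carrier_mat m m. \<exists>Q \<in> carrier_mat n n. \<exists>D \<in> carrier_mat m n.
          invertible_mat P \<and> invertible_mat Q \<and> P * A * Q = D \<and> diagonal_mat D \<and>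
          (\<forall>i. Suc i < min m n \<longrightarrow>
             two_sided_ideal hull {D $$ (Suc i, Suc i)}
               \<subseteq> left_multiples (D $$ (i, i)) \<inter> right_multiples (D $$ (i, i))))"

definition duo_ring :: "'a::ring_1 itself \<Rightarrow> bool" where
  "duo_ring (_ :: 'a itself) \<longleftrightarrow>
     (\<forall>I :: 'a set. right_ideal I \<longrightarrow> two_sided_ideal I) \<and>
     (\<forall>I :: 'a set. left_ideal I \<longrightarrow> two_sided_ideal I)"

end

theory Submission
  imports Defs
begin

text \<open>
  Suppose \<open>R\<close> is an elementary divisor ring, let \<open>a \<in> R\<close>, and let \<open>P (a I) Q = diag(z, e)\<close> be the
  reduction of the scalar \<open>2 \<times> 2\<close> matrix, with \<open>ReR \<subseteq> zR \<inter> Rz\<close>. By stable range 1 each column of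
  \<open>P\<close> can be combined to a unit, and by the Kazimirsky condition units can be moved across \<open>a\<close>.
  Modulo \<open>ReR\<close> the second row of \<open>P\<close> annihilates \<open>a\<close>, so both entries of its first row act on
  \<open>a\<close> like units; as \<open>P\<close> is invertible this forces \<open>a \<in> ReR\<close>. Hence \<open>zR = ReR = Rz\<close>, and a further
  use of stable range 1 gives \<open>aR = zR\<close> and \<open>Ra = Rz\<close>.

  Conversely, in a Bezout ring of stable range 1 any \<open>aR + bR\<close> is generated by some \<open>a + bs\<close>. If the
  ring is duo, elementary row and column operations therefore produce an entry generating the ideal
  of all entries; clearing its row and column and recursing yields the diagonal form.
\<close>

section \<open>Stable range 1 and the Kazimirsky condition\<close>

lemma right_multiples_iff: "x \<in> right_multiples a \<longleftrightarrow> (\<exists>r. x = a * r)"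
  by (auto simp: right_multiples_def)

lemma left_multiples_iff: "x \<in> left_multiples a \<longleftrightarrow> (\<exists>r. x = r * a)"
  by (auto simp: left_multiples_def)

lemma right_ideal_right_multiples: "right_ideal (right_multiples a)"
  unfolding right_ideal_def
proof (intro conjI ballI allI)
  show "0 \<in> right_multiples a"
    unfolding right_multiples_iff by (metis mult_zero_right)
next
  fix x y assume "x \<in> right_multiples a" "y \<in> right_multiples a"
  then show "x - y \<in> right_multiples a"
    unfolding right_multiples_iff by (metis right_diff_distrib)
next
  fix x r assume "x \<in> right_multiples a"
  then show "x * r \<in> right_multiples a"
    unfolding right_multiples_iff by (metis mult.assoc)
qed

lemma left_ideal_left_multiples: "left_ideal (left_multiples a)"
  unfolding left_ideal_def
proof (intro conjI ballI allI)
  show "0 \<in> left_multiples a"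
    unfolding left_multiples_iff by (metis mult_zero_left)
next
  fix x y assume "x \<in> left_multiples a" "y \<in> left_multiples a"
  then show "x - y \<in> left_multiples a"
    unfolding left_multiples_iff by (metis left_diff_distrib)
next
  fix x r assume "x \<in> left_multiples a"
  then show "r * x \<in> left_multiples a"
    unfolding left_multiples_iff by (metis mult.assoc)
qed

lemma right_multiples_mult_subset: "right_multiples (a * r) \<subseteq> right_multiples a"
  by (auto simp: right_multiples_def mult.assoc)

lemma left_multiples_mult_subset: "left_multiples (r * a) \<subseteq> left_multiples a"
  by (auto simp: left_multiples_def simp flip: mult.assoc)

lemma right_ideal_addD: "right_ideal I \<Longrightarrow> x \<in> I \<Longrightarrow> y \<in> I \<Longrightarrow> x + y \<in> I"
  unfolding right_ideal_def by (metis diff_0 diff_minus_eq_add)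

lemma right_ideal_multD: "right_ideal I \<Longrightarrow> x \<in> I \<Longrightarrow> x * r \<in> I"
  by (simp add: right_ideal_def)

lemma left_ideal_multD: "left_ideal I \<Longrightarrow> x \<in> I \<Longrightarrow> r * x \<in> I"
  by (simp add: left_ideal_def)

lemma bezout_right_gcd:
  assumes "bezout_ring TYPE('a::ring_1)"
  obtains d x y p q where "d = a * x + b * y" "a = d * p" "b = d * (q::'a)"
proof -
  obtain d where d: "right_ideal hull {a, b} = right_multiples d"
    using assms unfolding bezout_ring_def by (metis finite.simps)
  \<comment> \<open>\<open>S\<close> is the explicit form of aR + bR. As a right ideal containing
    \<open>a\<close> and \<open>b\<close>, it contains the hull, so the generator \<open>d\<close>
    is itself a combination of \<open>a\<close> and \<open>b\<close>.\<close>
  define S where "S = {v. \<exists>x y. v = a * x + b * y}"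
  have S: "a * x + b * y \<in> S" for x y
    unfolding S_def by blast
  have S_elim: "\<exists>x y. v = a * x + b * y" if "v \<in> S" for v
    using that unfolding S_def by simp
  have "right_ideal S"
    unfolding right_ideal_def
  proof (intro conjI ballI allI)
    show "0 \<in> S"
      using S[of 0 0] by simp
  next
    fix v w assume "v \<in> S" "w \<in> S"
    then obtain x y x' y' where "v = a * x + b * y" "w = a * x' + b * y'"
      by (metis S_elim)
    then have "v - w = a * (x - x') + b * (y - y')"
      by (simp add: algebra_simps)
    then show "v - w \<in> S"
      by (simp only: S)
  next
    fix v r assume "v \<in> S"
    then obtain x y where "v = a * x + b * y"
      by (metis S_elim)
    then have "v * r = a * (x * r) + b * (y * r)"
      by (simp add: algebra_simps)
    then show "v * r \<in> S"
      by (simp only: S)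
  qed
  moreover have "{a, b} \<subseteq> S"
    using S[of 1 0] S[of 0 1] by simp
  ultimately have "right_multiples d \<subseteq> S"
    using hull_minimal[of "{a, b}" S right_ideal] d by simp
  moreover have "d \<in> right_multiples d"
    unfolding right_multiples_iff by (metis mult_1_right)
  ultimately have "d \<in> S"
    by (rule subsetD)
  then obtain x y where "d = a * x + b * y"
    by (metis S_elim)
  moreover have "{a, b} \<subseteq> right_multiples d"
    using hull_subset[of "{a, b}" right_ideal] d by simp
  then obtain p q where "a = d * p" "b = d * q"
    by (metis insert_subset right_multiples_iff)
  ultimately show ?thesis
    by (rule that)
qed

section \<open>Units from the stable range condition\<close>

lemma stable_range_1_right_inverse:
  assumes "stable_range_1 TYPE('a::ring_1)" "a * x + b * y = (1::'a)"
  obtains t v where "(a + b * t) * v = 1"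
proof -
  have "r \<in> right_multiples a + right_multiples b" for r
  proof -
    have "r = (a * x + b * y) * r"
      using assms(2) by simp
    also have "\<dots> = a * (x * r) + b * (y * r)"
      by (simp only: distrib_right mult.assoc)
    finally have "r = a * (x * r) + b * (y * r)" .
    moreover have "a * (x * r) \<in> right_multiples a" "b * (y * r) \<in> right_multiples b"
      unfolding right_multiples_iff by blast+
    ultimately show ?thesis
      using set_plus_intro by metis
  qed
  then have "right_multiples a + right_multiples b = UNIV"
    by auto
  then obtain t where "right_multiples (a + b * t) = UNIV"
    using assms(1) unfolding stable_range_1_def by metis
  then have "1 \<in> right_multiples (a + b * t)"
    by simp
  then obtain v where "1 = (a + b * t) * v"
    unfolding right_multiples_iff ..
  then show ?thesis
    using that[of t v] by simp
qed

text \<open>Stable range 1 applied to kh + (1 - kh) = 1 gives a right invertible g = k + (1 - kh)t.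
  Since h(1 - kh) = 0, also hg = hk = 1, so g is a unit with inverse h. Both k and g are then right
  inverses of the unit h, hence equal.\<close>

lemma stable_range_1_dedekind_finite:
  assumes "stable_range_1 TYPE('a::ring_1)" "h * k = (1::'a)"
  shows "k * h = 1"
proof -
  have "k * h + (1 - k * h) * 1 = 1"
    by simp
  from stable_range_1_right_inverse[OF assms(1) this]
  obtain t v where tv: "(k + (1 - k * h) * t) * v = 1"
    by blast
  define g where "g = k + (1 - k * h) * t"
  have "h * g = h * k + (h - (h * k) * h) * t"
    by (simp add: g_def algebra_simps)
  then have "h * g = 1"
    using assms(2) by simp
  then have "g * h = 1"
    using tv unfolding g_def[symmetric] by (metis mult.assoc mult_1_left mult_1_right)
  then show ?thesis
    using assms(2) \<open>h * g = 1\<close> by (metis mult.assoc mult_1_left mult_1_right)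
qed

lemma stable_range_1_unit:
  assumes "stable_range_1 TYPE('a::ring_1)" "a * x + b * y = (1::'a)"
  obtains t where "invertible_elem (a + b * t)"
proof -
  obtain t v where tv: "(a + b * t) * v = 1"
    using stable_range_1_right_inverse[OF assms] .
  with stable_range_1_dedekind_finite[OF assms(1) tv]
  have "invertible_elem (a + b * t)"
    unfolding invertible_elem_def by blast
  then show ?thesis
    by (rule that)
qed

text \<open>Vaserstein's symmetry of the stable range condition; the explicit left inverse is Lam's.\<close>

lemma stable_range_1_unit_left:
  assumes "stable_range_1 TYPE('a::ring_1)" "p * a + q * b = (1::'a)"
  obtains t where "invertible_elem (a + t * b)"
proof -
  define c where "c = q * b"
  have pac: "p * a + c * 1 = 1"
    using assms(2) by (simp add: c_def)
  obtain y where "invertible_elem (p + c * y)"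
    using stable_range_1_unit[OF assms(1) pac] .
  then obtain v where v: "(p + c * y) * v = 1"
    by (metis invertible_elem_def)
  have c: "c = 1 - p * a"
    using pac by (simp add: eq_diff_eq add.commute)
  have u: "p + y - p * a * y = p + c * y"
    by (simp add: c algebra_simps)
  \<comment> \<open>The first factor is the left inverse. Multiplied by \<open>a\<close> it gives pa
    + yac, and multiplied by 1 - ay it gives (1 - ya)(p + y - pay), whose last factor is the unit
    that \<open>v\<close> inverts. The terms yac then cancel and pa + c = 1 remains.\<close>
  have "(p + y * (1 - a * p)) * (a + (1 - a * y) * v * c) =
      p * a + y * a * c + (1 - y * a) * ((p + y - p * a * y) * v) * c"
    by (simp add: c algebra_simps)
  also have "\<dots> = 1"
    unfolding u v by (simp add: c algebra_simps)
  finally have "(p + y * (1 - a * p)) * (a + (1 - a * y) * v * c) = 1" .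
  with stable_range_1_dedekind_finite[OF assms(1) this]
  have "invertible_elem (a + (1 - a * y) * v * c)"
    unfolding invertible_elem_def by blast
  moreover have "(1 - a * y) * v * c = ((1 - a * y) * v * q) * b"
    by (simp only: c_def mult.assoc)
  ultimately show ?thesis
    using that[of "(1 - a * y) * v * q"] by simp
qed

section \<open>Moving units with the Kazimirsky condition\<close>

lemma right_kazimirskyE:
  assumes "right_kazimirsky TYPE('a::ring_1)" "invertible_elem (u::'a)"
  obtains m where "u * a = a * m"
proof -
  have "a \<in> right_multiples a"
    unfolding right_multiples_iff by (metis mult_1_right)
  moreover have "(*) u ` right_multiples a \<subseteq> right_multiples a"
    using assms by (simp add: right_kazimirsky_def)
  ultimately have "\<exists>m. u * a = a * m"
    by (simp only: image_subset_iff right_multiples_iff)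
  then show ?thesis
    using that by metis
qed

lemma left_kazimirskyE:
  assumes "left_kazimirsky TYPE('a::ring_1)" "invertible_elem (u::'a)"
  obtains m where "a * u = m * a"
proof -
  have "a \<in> left_multiples a"
    unfolding left_multiples_iff by (metis mult_1_left)
  moreover have "(\<lambda>x. x * u) ` left_multiples a \<subseteq> left_multiples a"
    using assms by (simp add: left_kazimirsky_def)
  ultimately have "\<exists>m. a * u = m * a"
    by (simp only: image_subset_iff left_multiples_iff)
  then show ?thesis
    using that by metis
qed

text \<open>The inverse of \<open>u\<close> maps zR into itself, so it can be applied to both sides
  of the equation without leaving zR.\<close>

lemma right_kazimirsky_divide:
  assumes "right_kazimirsky TYPE('a::ring_1)" "invertible_elem (u::'a)" "u * a = z * r"
  obtains s where "a = z * s"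
proof -
  obtain v where v: "u * v = 1" "v * u = 1"
    using assms(2) by (metis invertible_elem_def)
  then have "invertible_elem v"
    by (metis invertible_elem_def)
  from right_kazimirskyE[OF assms(1) this] obtain m where m: "v * z = z * m" .
  have "v * (u * a) = v * (z * r)"
    using assms(3) by simp
  then have "a = z * (m * r)"
    using v m by (simp flip: mult.assoc)
  then show ?thesis
    by (rule that)
qed

text \<open>From z = at = zst it follows that z(1 - st) = 0. Changing \<open>s\<close> by a right
  multiple of 1 - st therefore keeps the product with \<open>z\<close>, and stable range 1 makes
  some such change a unit. No cancellation of \<open>z\<close> is involved.\<close>

lemma stable_range_1_associates:
  assumes "stable_range_1 TYPE('a::ring_1)" "a = z * s" "z = a * t"
  obtains u where "invertible_elem u" "z * u = (a::'a)"
proof -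
  have "s * t + (1 - s * t) * 1 = 1"
    by simp
  from stable_range_1_unit[OF assms(1) this]
  obtain h where h: "invertible_elem (s + (1 - s * t) * h)" .
  have "z * s + (z - (z * s) * t) * h = a"
    using assms(2,3) by simp
  then have "z * (s + (1 - s * t) * h) = a"
    by (simp add: algebra_simps)
  with h that show ?thesis
    by blast
qed

section \<open>Elementary divisor rings are duo\<close>

lemma two_sided_ideal_hull: "two_sided_ideal (two_sided_ideal hull S)"
  by (rule hull_in) (auto simp: two_sided_ideal_def right_ideal_def left_ideal_def)

text \<open>\<open>invertible_mat\<close> does not state the size of the inverse; comparing the
  column counts in the two product equations recovers it.\<close>

lemma invertible_mat_obtain_inverse:
  assumes "M \<in> carrier_mat n n" "invertible_mat M"
  obtains N where "N \<in> carrier_mat n n" "M * N = 1\<^sub>m n" "N * M = 1\<^sub>m n"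
proof -
  obtain N where N: "M * N = 1\<^sub>m (dim_row M)" "N * M = 1\<^sub>m (dim_row N)"
    using assms(2) unfolding invertible_mat_def inverts_mat_def by blast
  have "dim_col (M * N) = n" "dim_col (N * M) = dim_row N"
    unfolding N using assms(1) by simp_all
  then have "N \<in> carrier_mat n n"
    using assms(1) by auto
  with N assms(1) that show ?thesis
    by auto
qed

text \<open>Entrywise form of a reduction P(aI)Q = diag(z, e), used as P(aI) = diag(z, e) T with T
  the inverse of Q. The \<open>p\<close> and \<open>q\<close> are the entries of P and T, the
  \<open>r\<close> those of the inverse of P, and \<open>s1\<close>, \<open>s2\<close> form the
  first column of Q.\<close>

lemma elementary_divisor_ring_scalar_2x2:
  fixes a :: "'a::ring_1"
  assumes "elementary_divisor_ring TYPE('a)"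
  obtains z e p11 p12 p21 p22 r11 r12 r21 r22 q11 q12 q21 q22 s1 s2 :: 'a where
    "two_sided_ideal hull {e} \<subseteq> left_multiples z \<inter> right_multiples z"
    "p11 * a = z * q11" "p12 * a = z * q12" "p21 * a = e * q21" "p22 * a = e * q22"
    "r11 * p11 + r12 * p21 = 1" "r11 * p12 + r12 * p22 = 0"
    "r21 * p11 + r22 * p21 = 0" "r21 * p12 + r22 * p22 = 1"
    "q11 * s1 + q12 * s2 = 1" "q21 * s1 + q22 * s2 = 0"
proof -
  define A where "A = a \<cdot>\<^sub>m 1\<^sub>m 2"
  have A: "A \<in> carrier_mat 2 2"
    by (simp add: A_def)
  have entries: "(M * N) $$ (i, j) = M $$ (i, 0) * N $$ (0, j) + M $$ (i, 1) * N $$ (1, j)"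
    if "M \<in> carrier_mat 2 2" "N \<in> carrier_mat 2 2" "i < 2" "j < 2" for M N :: "'a mat" and i j
    using that by (simp add: scalar_prod_def numeral_2_eq_2)
  obtain P Q D where PQD: "P \<in> carrier_mat 2 2" "Q \<in> carrier_mat 2 2" "D \<in> carrier_mat 2 2"
      "invertible_mat P" "invertible_mat Q" "P * A * Q = D" "diagonal_mat D"
      "\<forall>i. Suc i < min 2 2 \<longrightarrow> two_sided_ideal hull {D $$ (Suc i, Suc i)}
         \<subseteq> left_multiples (D $$ (i, i)) \<inter> right_multiples (D $$ (i, i))"
    using assms[unfolded elementary_divisor_ring_def, rule_format, OF A] by (elim bexE conjE) (rule that)
  obtain R where R: "R \<in> carrier_mat 2 2" "R * P = 1\<^sub>m 2"
    using invertible_mat_obtain_inverse[OF PQD(1,4)] .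
  obtain T where T: "T \<in> carrier_mat 2 2" "T * Q = 1\<^sub>m 2" "Q * T = 1\<^sub>m 2"
    using invertible_mat_obtain_inverse[OF PQD(2,5)] .
  have PA: "P * A \<in> carrier_mat 2 2"
    using PQD(1) A by simp
  have "D * T = P * A * (Q * T)"
    unfolding PQD(6)[symmetric] using assoc_mult_mat[OF PA PQD(2) T(1)] .
  also have "\<dots> = P * A"
    using T(3) right_mult_one_mat[OF PA] by simp
  finally have DT: "P * A = D * T" ..
  have "D $$ (0, 1) = 0" "D $$ (1, 0) = 0"
    using PQD(3,7) unfolding diagonal_mat_def by auto
  moreover have "A $$ (0, 0) = a" "A $$ (0, 1) = 0" "A $$ (1, 0) = 0" "A $$ (1, 1) = a"
    by (simp_all add: A_def)
  ultimately have "P $$ (i, j) * a = D $$ (i, i) * T $$ (i, j)" if "i \<in> {0, 1}" "j \<in> {0, 1}" for i j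
    using entries[OF PQD(1) A, of i j] entries[OF PQD(3) T(1), of i j] DT that by auto
  then have *: "P $$ (0, 0) * a = D $$ (0, 0) * T $$ (0, 0)" "P $$ (0, 1) * a = D $$ (0, 0) * T $$ (0, 1)"
      "P $$ (1, 0) * a = D $$ (1, 1) * T $$ (1, 0)" "P $$ (1, 1) * a = D $$ (1, 1) * T $$ (1, 1)"
    by simp_all
  have RP: "R $$ (0, 0) * P $$ (0, 0) + R $$ (0, 1) * P $$ (1, 0) = 1"
    "R $$ (0, 0) * P $$ (0, 1) + R $$ (0, 1) * P $$ (1, 1) = 0"
    "R $$ (1, 0) * P $$ (0, 0) + R $$ (1, 1) * P $$ (1, 0) = 0"
    "R $$ (1, 0) * P $$ (0, 1) + R $$ (1, 1) * P $$ (1, 1) = 1"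
    using entries[OF R(1) PQD(1), of 0 0] entries[OF R(1) PQD(1), of 0 1]
      entries[OF R(1) PQD(1), of 1 0] entries[OF R(1) PQD(1), of 1 1]
    by (simp_all add: R(2))
  have TQ: "T $$ (0, 0) * Q $$ (0, 0) + T $$ (0, 1) * Q $$ (1, 0) = 1"
    "T $$ (1, 0) * Q $$ (0, 0) + T $$ (1, 1) * Q $$ (1, 0) = 0"
    using entries[OF T(1) PQD(2), of 0 0] entries[OF T(1) PQD(2), of 1 0]
    by (simp_all add: T(2))
  have "two_sided_ideal hull {D $$ (1, 1)} \<subseteq> left_multiples (D $$ (0, 0)) \<inter> right_multiples (D $$ (0, 0))"
    using PQD(8) by simp
  from that[OF this * RP TQ] show ?thesis .
qed

lemma normal_generator:
  fixes a :: "'a::ring_1"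
  assumes sr: "stable_range_1 TYPE('a)" and kaz: "right_kazimirsky TYPE('a)"
    and edr: "elementary_divisor_ring TYPE('a)"
  obtains z s t where "a = z * s" "z = a * t" "left_multiples z = right_multiples z"
proof -
  obtain z e p11 p12 p21 p22 r11 r12 r21 r22 q11 q12 q21 q22 s1 s2 :: 'a where
    hull: "two_sided_ideal hull {e} \<subseteq> left_multiples z \<inter> right_multiples z"
    and pa: "p11 * a = z * q11" "p12 * a = z * q12" "p21 * a = e * q21" "p22 * a = e * q22"
    and rp: "r11 * p11 + r12 * p21 = 1" "r11 * p12 + r12 * p22 = 0" "r21 * p11 + r22 * p21 = 0" "r21 * p12 + r22 * p22 = 1"
    and qs: "q11 * s1 + q12 * s2 = 1" "q21 * s1 + q22 * s2 = 0"
    using elementary_divisor_ring_scalar_2x2[OF edr] .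
  define I where "I = two_sided_ideal hull {e}"
  have e: "e \<in> I"
    unfolding I_def by (rule hull_inc) simp
  have I: "right_ideal I" "left_ideal I"
    using two_sided_ideal_hull[of "{e}"] unfolding I_def two_sided_ideal_def by simp_all
  have eI: "x * e * y \<in> I" for x y
    using e I by (simp add: right_ideal_multD left_ideal_multD)
  have I_sub: "I \<subseteq> right_multiples z" "I \<subseteq> left_multiples z"
    using hull unfolding I_def by simp_all
  obtain t where u: "invertible_elem (p11 + t * p21)"
    using stable_range_1_unit_left[OF sr rp(1)] .
  \<comment> \<open>\<open>t'\<close> is chosen independently of \<open>t\<close>; it serves only to
    show that \<open>a\<close> lies in \<open>I\<close>.\<close>
  obtain t' where u': "invertible_elem (p12 + t' * p22)"
    using stable_range_1_unit_left[OF sr rp(4)] .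
  have "t * e * 1 \<in> right_multiples z"
    using eI I_sub(1) by blast
  then obtain e1 where e1: "t * e = z * e1"
    unfolding right_multiples_iff by auto
  have ua: "(p11 + t * p21) * a = z * (q11 + e1 * q21)"
  proof -
    have "(p11 + t * p21) * a = p11 * a + t * (p21 * a)"
      by (simp add: algebra_simps)
    also have "\<dots> = z * q11 + (t * e) * q21"
      by (simp add: pa mult.assoc)
    finally show ?thesis
      by (simp add: e1 algebra_simps)
  qed
  obtain s where s: "a = z * s"
    using right_kazimirsky_divide[OF kaz u ua] .
  obtain m where m: "(p11 + t * p21) * a = a * m"
    using right_kazimirskyE[OF kaz u] .
  obtain m' where m': "(p12 + t' * p22) * a = a * m'"
    using right_kazimirskyE[OF kaz u'] .
  \<comment> \<open>With ua in the role of \<open>z\<close> and 1 in that of \<open>r\<close>,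
    cancelling the unit puts \<open>a\<close> itself into uaR.\<close>
  obtain n where n: "a = (p11 + t * p21) * a * n"
    using right_kazimirsky_divide[OF kaz u, of a "(p11 + t * p21) * a" 1] by auto
  \<comment> \<open>Modulo \<open>I\<close>: \<open>p12 a = a m' = p11 a n m'\<close>, so \<open>a = r21 p12 a = r21 p11 a n m' = 0\<close>.\<close>
  have "a \<in> I"
  proof -
    have "p12 * a = (p12 + t' * p22) * a - t' * (p22 * a)"
      by (simp add: algebra_simps)
    also have "\<dots> = a * m' - t' * e * q22"
      by (simp add: m' pa mult.assoc)
    also have "a * m' = (p11 + t * p21) * a * (n * m')"
      by (subst n) (simp only: mult.assoc)
    also have "\<dots> = p11 * a * (n * m') + t * (p21 * a) * (n * m')"
      by (simp add: algebra_simps)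
    finally have p12a: "p12 * a = p11 * a * (n * m') + t * e * (q21 * n * m') - t' * e * q22"
      by (simp add: pa(3) mult.assoc)
    have "r21 * p11 = - (r22 * p21)"
      using rp(3) by (simp add: eq_neg_iff_add_eq_0)
    then have "r21 * p11 * a = - (r22 * (p21 * a))"
      by (simp add: mult.assoc)
    then have rpa: "r21 * p11 * a = - r22 * e * q21"
      by (simp add: pa(3) mult.assoc)
    have "a = r21 * (p12 * a) + r22 * (p22 * a)"
      using arg_cong[OF rp(4), of "\<lambda>x. x * a"] by (simp add: distrib_right mult.assoc)
    also have "\<dots> = r21 * p11 * a * (n * m') + (r21 * t) * e * (q21 * n * m')
        + (- r21 * t') * e * q22 + r22 * e * q22"
      by (simp add: p12a pa(4) algebra_simps)
    also have "\<dots> = (- r22) * e * (q21 * n * m') + (r21 * t) * e * (q21 * n * m')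
        + (- r21 * t') * e * q22 + r22 * e * q22"
      unfolding rpa by (simp add: mult.assoc)
    also have "\<dots> \<in> I"
      by (intro right_ideal_addD[OF I(1)] eI)
    finally show ?thesis .
  qed
  \<comment> \<open>Unimodularity of the first row of T expresses \<open>z\<close> through p11 a and
    p12 a, so \<open>z\<close> inherits membership in \<open>I\<close>. All multiples of
    \<open>z\<close> on either side then lie in \<open>I\<close>, which is contained in both zR and
    Rz.\<close>
  have "z = z * (q11 * s1 + q12 * s2)"
    by (simp add: qs(1))
  also have "\<dots> = p11 * a * s1 + p12 * a * s2"
    by (simp add: pa algebra_simps)
  also have "\<dots> \<in> I"
    using \<open>a \<in> I\<close> I by (simp add: right_ideal_addD right_ideal_multD left_ideal_multD)
  finally have "z \<in> I" .
  then have "r * z \<in> I" "z * r \<in> I" for r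
    using I by (simp_all add: right_ideal_multD left_ideal_multD)
  then have normal: "\<exists>m. r * z = z * m" "\<exists>m. z * r = m * z" for r
    using I_sub by (auto simp: subset_iff right_multiples_iff left_multiples_iff)
  \<comment> \<open>The same \<open>t\<close> as in the unit p11 + t p21: adding \<open>t\<close>
    times the second row of P changes the first row of T only by \<open>e1\<close> times its second
    row. As the latter is orthogonal to (s1, s2), the modified row still combines to
    \<open>z\<close>.\<close>
  define p where "p = p12 + t * p22"
  have pa': "p * a = z * (q12 + e1 * q22)"
  proof -
    have "p * a = p12 * a + t * (p22 * a)"
      by (simp add: p_def algebra_simps)
    also have "\<dots> = z * q12 + (t * e) * q22"
      by (simp add: pa mult.assoc)
    finally show ?thesis
      by (simp add: e1 algebra_simps)
  qed
  obtain y where y: "p * z = z * y"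
    using normal(1) by blast
  have pa_y: "p * a = z * y * s"
    by (simp add: s y flip: mult.assoc)
  have "z = z * ((q11 * s1 + q12 * s2) + e1 * (q21 * s1 + q22 * s2))"
    by (simp add: qs)
  also have "\<dots> = (p11 + t * p21) * a * s1 + p * a * s2"
    unfolding ua pa' by (simp add: algebra_simps)
  finally have z: "z = a * m * s1 + z * y * s * s2"
    unfolding m pa_y .
  \<comment> \<open>The annihilator element \<open>w\<close> takes the place of cancelling \<open>z\<close>, which may be a zero divisor.\<close>
  define w where "w = 1 - s * m * s1 - y * s * s2"
  have "z * w = z - a * m * s1 - z * y * s * s2"
    by (simp add: w_def s algebra_simps)
  also have "\<dots> = 0"
    using z by (simp add: algebra_simps)
  finally have zw: "z * w = 0" .
  \<comment> \<open>The coefficient \<open>y\<close> is replaced by a unit, which can be moved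
    across \<open>s\<close>. The correction is harmless: \<open>z\<close> times s m s1 + w lies in
    aR because zs = a and zw = 0. This puts z y s, and with it \<open>z\<close>, into aR.\<close>
  have "y * (s * s2) + (s * m * s1 + w) * 1 = 1"
    by (simp add: w_def algebra_simps)
  from stable_range_1_unit[OF sr this] obtain h where h: "invertible_elem (y + (s * m * s1 + w) * h)" .
  obtain v where v: "(y + (s * m * s1 + w) * h) * s = s * v"
    using right_kazimirskyE[OF kaz h] .
  have "z * y * s = z * ((y + (s * m * s1 + w) * h) * s) - z * s * m * s1 * h * s - z * w * h * s"
    by (simp add: algebra_simps)
  also have "\<dots> = a * (v - m * s1 * h * s)"
    unfolding v zw by (simp add: s algebra_simps)
  finally have zys: "z * y * s = a * (v - m * s1 * h * s)" .
  note z
  also have "a * m * s1 + z * y * s * s2 = a * (m * s1 + (v - m * s1 * h * s) * s2)"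
    unfolding zys by (simp add: algebra_simps)
  finally have "z = a * (m * s1 + (v - m * s1 * h * s) * s2)" .
  moreover have "left_multiples z = right_multiples z"
  proof (intro equalityI subsetI)
    fix x assume "x \<in> left_multiples z"
    with normal(1) show "x \<in> right_multiples z"
      by (metis left_multiples_iff right_multiples_iff)
  next
    fix x assume "x \<in> right_multiples z"
    with normal(2) show "x \<in> left_multiples z"
      by (metis left_multiples_iff right_multiples_iff)
  qed
  ultimately show ?thesis
    by (rule that[OF s])
qed

lemma duo_ring_iff: "duo_ring TYPE('a::ring_1) \<longleftrightarrow> (\<forall>a::'a. left_multiples a = right_multiples a)"
proof
  assume duo: "duo_ring TYPE('a)"
  show "\<forall>a::'a. left_multiples a = right_multiples a"
  proof (intro allI equalityI subsetI)
    fix a x :: 'a assume "x \<in> left_multiples a"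
    then obtain r where "x = r * a"
      by (auto simp: left_multiples_iff)
    moreover have "left_ideal (right_multiples a)"
      using duo right_ideal_right_multiples[of a] unfolding duo_ring_def two_sided_ideal_def by blast
    moreover have "a \<in> right_multiples a"
      unfolding right_multiples_iff by (metis mult_1_right)
    ultimately show "x \<in> right_multiples a"
      by (simp add: left_ideal_multD)
  next
    fix a x :: 'a assume "x \<in> right_multiples a"
    then obtain r where "x = a * r"
      by (auto simp: right_multiples_iff)
    moreover have "right_ideal (left_multiples a)"
      using duo left_ideal_left_multiples[of a] unfolding duo_ring_def two_sided_ideal_def by blast
    moreover have "a \<in> left_multiples a"
      unfolding left_multiples_iff by (metis mult_1_left)
    ultimately show "x \<in> left_multiples a"
      by (simp add: right_ideal_multD)
  qed
next
  assume eq: "\<forall>a::'a. left_multiples a = right_multiples a"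
  have normal: "\<exists>m. r * a = a * m" "\<exists>m. a * r = m * a" for a r :: 'a
    using eq by (auto simp: set_eq_iff right_multiples_iff left_multiples_iff)
  have "left_ideal I" if I: "right_ideal I" for I :: "'a set"
    unfolding left_ideal_def
  proof (intro conjI ballI allI)
    fix x r assume "x \<in> I"
    with normal(1)[of r x] I show "r * x \<in> I"
      by (auto simp: right_ideal_multD)
  qed (use I in \<open>simp_all add: right_ideal_def\<close>)
  moreover have "right_ideal I" if I: "left_ideal I" for I :: "'a set"
    unfolding right_ideal_def
  proof (intro conjI ballI allI)
    fix x r assume "x \<in> I"
    with normal(2)[of x r] I show "x * r \<in> I"
      by (auto simp: left_ideal_multD)
  qed (use I in \<open>simp_all add: left_ideal_def\<close>)
  ultimately show "duo_ring TYPE('a)"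
    unfolding duo_ring_def two_sided_ideal_def by (intro conjI allI impI)
qed

text \<open>The normal generator \<open>z\<close> of aR satisfies a = zu for a unit
  \<open>u\<close>. The left Kazimirsky condition moves \<open>u\<close> and its inverse to the
  left, so also Ra = Rz, and normality of \<open>z\<close> passes to \<open>a\<close>.\<close>

lemma elementary_divisor_ring_imp_duo_ring:
  assumes sr: "stable_range_1 TYPE('a::ring_1)" and kaz: "kazimirsky TYPE('a)"
    and edr: "elementary_divisor_ring TYPE('a)"
  shows "duo_ring TYPE('a)"
proof -
  have rkaz: "right_kazimirsky TYPE('a)" and lkaz: "left_kazimirsky TYPE('a)"
    using kaz by (simp_all add: kazimirsky_def)
  have "left_multiples a = right_multiples a" for a :: 'a
  proof -
    obtain z s t where a: "a = z * s" and z: "z = a * t"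
      and normal: "left_multiples z = right_multiples z"
      using normal_generator[OF sr rkaz edr] .
    obtain u where u: "invertible_elem u" "z * u = a"
      using stable_range_1_associates[OF sr a z] .
    obtain v where uv: "u * v = 1" "v * u = 1"
      using u(1) by (metis invertible_elem_def)
    then have "invertible_elem v"
      by (metis invertible_elem_def)
    moreover have "z * u * v = z"
      by (simp add: mult.assoc uv(1))
    ultimately have v: "invertible_elem v" "a * v = z"
      by (simp_all only: u(2))
    obtain k where k: "z * u = k * z"
      using left_kazimirskyE[OF lkaz u(1)] .
    obtain l where l: "a * v = l * a"
      using left_kazimirskyE[OF lkaz v(1)] .
    have "right_multiples a = right_multiples z"
      using right_multiples_mult_subset[of z s] right_multiples_mult_subset[of a t]
      unfolding a[symmetric] z[symmetric] by (rule equalityI)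
    moreover have "left_multiples a = left_multiples z"
      using left_multiples_mult_subset[of k z] left_multiples_mult_subset[of l a]
      unfolding k[symmetric] l[symmetric] u(2) v(2) by (rule equalityI)
    ultimately show ?thesis
      using normal by simp
  qed
  then show ?thesis
    by (simp add: duo_ring_iff)
qed

section \<open>Diagonal reduction over duo rings\<close>

text \<open>Write a = dp and b = dq with d = ax + by. The pair (p, q) need not be unimodular, since
  \<open>d\<close> may be a zero divisor, but the defect w = 1 - px - qy satisfies dw = 0. Stable
  range 1 yields a unit p + (qy + w)t, and multiplying it by \<open>d\<close> gives a + byt, which
  thus generates dR.\<close>

lemma right_gcd_elementary:
  assumes bezout: "bezout_ring TYPE('a::ring_1)" and sr: "stable_range_1 TYPE('a)"
  obtains s where "a \<in> right_multiples (a + b * s)" "b \<in> right_multiples (a + b * (s::'a))"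
proof -
  obtain d x y p q where d: "d = a * x + b * y" and a: "a = d * p" and b: "b = d * q"
    using bezout_right_gcd[OF bezout] .
  define w where "w = 1 - p * x - q * y"
  have "d * w = d - (d * p * x + d * q * y)"
    by (simp add: w_def algebra_simps)
  then have dw: "d * w = 0"
    using d unfolding a[symmetric] b[symmetric] by simp
  have "p * x + (q * y + w) * 1 = 1"
    by (simp add: w_def)
  from stable_range_1_unit[OF sr this]
  obtain t where "invertible_elem (p + (q * y + w) * t)" .
  then obtain v where v: "(p + (q * y + w) * t) * v = 1"
    by (metis invertible_elem_def)
  have "a + b * (y * t) = d * p + d * q * (y * t) + d * w * t"
    unfolding dw a[symmetric] b[symmetric] by simp
  also have "\<dots> = d * (p + (q * y + w) * t)"
    by (simp add: algebra_simps)
  finally have "(a + b * (y * t)) * v = d"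
    by (simp add: mult.assoc v)
  then have "a = (a + b * (y * t)) * (v * p)" "b = (a + b * (y * t)) * (v * q)"
    using a b by (simp_all flip: mult.assoc)
  then show ?thesis
    using that[of "y * t"] unfolding right_multiples_iff by blast
qed

lemma right_ideal_sum:
  assumes "right_ideal S" "\<And>i. i \<in> F \<Longrightarrow> f i \<in> S"
  shows "sum f F \<in> S"
  using assms(2)
proof (induction F rule: infinite_finite_induct)
  case (insert i F)
  then show ?case
    using assms(1) by (simp add: right_ideal_addD)
qed (use assms(1) in \<open>simp_all add: right_ideal_def\<close>)

lemma right_multiples_subset:
  "a \<in> right_multiples b \<Longrightarrow> right_multiples a \<subseteq> right_multiples b"
  using right_multiples_mult_subset by (auto simp: right_multiples_iff)

lemma self_in_right_multiples: "a \<in> right_multiples a"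
  unfolding right_multiples_iff by (metis mult_1_right)

text \<open>The elements of \<open>F\<close> are absorbed one at a time: each step enlarges the
  principal right ideal, so the earlier memberships persist.\<close>

lemma right_gcd_elementary_sum:
  fixes b :: "'i \<Rightarrow> 'a::ring_1"
  assumes bezout: "bezout_ring TYPE('a)" and sr: "stable_range_1 TYPE('a)" and "finite F"
  shows "\<exists>x. insert a (b ` F) \<subseteq> right_multiples (a + (\<Sum>i\<in>F. b i * x i))"
  using \<open>finite F\<close>
proof induction
  case empty
  then show ?case
    by (simp add: self_in_right_multiples)
next
  case (insert f F)
  then obtain x where x: "insert a (b ` F) \<subseteq> right_multiples (a + (\<Sum>i\<in>F. b i * x i))"
    by blast
  obtain s where s: "a + (\<Sum>i\<in>F. b i * x i) \<in> right_multiples (a + (\<Sum>i\<in>F. b i * x i) + b f * s)"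
      "b f \<in> right_multiples (a + (\<Sum>i\<in>F. b i * x i) + b f * s)"
    using right_gcd_elementary[OF bezout sr] .
  have "(\<Sum>i\<in>F. b i * (x(f := s)) i) = (\<Sum>i\<in>F. b i * x i)"
    using insert.hyps by (intro sum.cong) auto
  then have *: "a + (\<Sum>i\<in>insert f F. b i * (x(f := s)) i) = a + (\<Sum>i\<in>F. b i * x i) + b f * s"
    using insert.hyps by (simp add: add_ac)
  have "insert a (b ` insert f F) \<subseteq> right_multiples (a + (\<Sum>i\<in>insert f F. b i * (x(f := s)) i))"
    unfolding * using x s(2) right_multiples_subset[OF s(1)] by auto
  then show ?case
    by (rule exI[of _ "x(f := s)"])
qed

text \<open>Matrices are functions here, so that reducing a submatrix needs no block decomposition.\<close>

inductive elementary_equiv ::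
  "nat set \<Rightarrow> nat set \<Rightarrow> (nat \<Rightarrow> nat \<Rightarrow> 'a::ring_1) \<Rightarrow> (nat \<Rightarrow> nat \<Rightarrow> 'a) \<Rightarrow> bool"
  for I J A where
  refl: "elementary_equiv I J A A"
| row: "elementary_equiv I J A B \<Longrightarrow> i \<in> I \<Longrightarrow> k \<in> I \<Longrightarrow> i \<noteq> k \<Longrightarrow>
    elementary_equiv I J A (B(i := \<lambda>j. B i j + x * B k j))"
| col: "elementary_equiv I J A B \<Longrightarrow> j \<in> J \<Longrightarrow> l \<in> J \<Longrightarrow> j \<noteq> l \<Longrightarrow>
    elementary_equiv I J A (\<lambda>i. (B i)(j := B i j + B i l * x))"

lemma elementary_equiv_trans:
  assumes "elementary_equiv I J A B" "elementary_equiv I J B C"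
  shows "elementary_equiv I J A C"
  using assms(2)
proof induction
  case refl
  show ?case
    by (rule assms(1))
next
  case (row B i k x)
  show ?case
    by (rule elementary_equiv.row[OF row.IH row.hyps(2-4)])
next
  case (col B j l x)
  show ?case
    by (rule elementary_equiv.col[OF col.IH col.hyps(2-4)])
qed

lemma elementary_equiv_mono:
  assumes "elementary_equiv I J A B" "I \<subseteq> I'" "J \<subseteq> J'"
  shows "elementary_equiv I' J' A B"
  using assms(1)
proof induction
  case refl
  show ?case
    by (rule elementary_equiv.refl)
next
  case (row B i k x)
  show ?case
    by (rule elementary_equiv.row[OF row.IH subsetD[OF assms(2) row.hyps(2)]
          subsetD[OF assms(2) row.hyps(3)] row.hyps(4)])
next
  case (col B j l x)
  show ?case
    by (rule elementary_equiv.col[OF col.IH subsetD[OF assms(3) col.hyps(2)]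
          subsetD[OF assms(3) col.hyps(3)] col.hyps(4)])
qed

text \<open>This and the next three lemmas are the invariants for recursion into a submatrix: the
  pivot survives, its cleared row and column stay zero, and divisibility of the remaining entries by
  the pivot is kept.\<close>

lemma elementary_equiv_outside:
  assumes "elementary_equiv I J A B" "i \<notin> I" "j \<notin> J"
  shows "B i j = A i j"
  using assms(1) by induction (use assms(2,3) in auto)

lemma elementary_equiv_row_zero:
  assumes "elementary_equiv I J A B" "i \<notin> I" "\<And>j. j \<in> J \<Longrightarrow> A i j = 0" "j \<in> J"
  shows "B i j = 0"
  using assms(1,4) by (induction arbitrary: j) (use assms(2,3) in auto)

lemma elementary_equiv_col_zero:
  assumes "elementary_equiv I J A B" "j \<notin> J" "\<And>i. i \<in> I \<Longrightarrow> A i j = 0" "i \<in> I"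
  shows "B i j = 0"
  using assms(1,4) by (induction arbitrary: i) (use assms(2,3) in auto)

lemma elementary_equiv_ideal:
  assumes "elementary_equiv I J A B" "right_ideal S" "left_ideal S"
    and "\<And>i j. i \<in> I \<Longrightarrow> j \<in> J \<Longrightarrow> A i j \<in> S" "i \<in> I" "j \<in> J"
  shows "B i j \<in> S"
  using assms(1,5,6)
  by (induction arbitrary: i j)
    (use assms(2-4) in \<open>auto simp: right_ideal_addD right_ideal_multD left_ideal_multD\<close>)

text \<open>Row \<open>k\<close> is outside \<open>F\<close>, so it stays fixed while the single
  operations are performed. This clears a column below a pivot.\<close>

lemma elementary_equiv_add_to_rows:
  assumes "finite F" "F \<subseteq> I" "k \<in> I" "k \<notin> F"
  shows "elementary_equiv I J A (\<lambda>i j. if i \<in> F then A i j + x i * A k j else A i j)"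
  using assms
proof induction
  case empty
  then show ?case
    by (simp add: elementary_equiv.refl)
next
  case (insert f F)
  let ?B = "\<lambda>i j. if i \<in> F then A i j + x i * A k j else A i j"
  have "elementary_equiv I J A ?B"
    using insert by simp
  then have "elementary_equiv I J A (?B(f := \<lambda>j. ?B f j + x f * ?B k j))"
    by (rule elementary_equiv.row) (use insert in auto)
  also have "?B(f := \<lambda>j. ?B f j + x f * ?B k j) =
      (\<lambda>i j. if i \<in> insert f F then A i j + x i * A k j else A i j)"
    using insert by (auto simp: fun_eq_iff)
  finally show ?case .
qed

lemma elementary_equiv_add_to_cols:
  assumes "finite F" "F \<subseteq> J" "l \<in> J" "l \<notin> F"
  shows "elementary_equiv I J A (\<lambda>i j. if j \<in> F then A i j + A i l * x j else A i j)"
  using assms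
proof induction
  case empty
  then show ?case
    by (simp add: elementary_equiv.refl)
next
  case (insert f F)
  let ?B = "\<lambda>i j. if j \<in> F then A i j + A i l * x j else A i j"
  have "elementary_equiv I J A ?B"
    using insert by simp
  then have "elementary_equiv I J A (\<lambda>i. (?B i)(f := ?B i f + ?B i l * x f))"
    by (rule elementary_equiv.col) (use insert in auto)
  also have "(\<lambda>i. (?B i)(f := ?B i f + ?B i l * x f)) =
      (\<lambda>i j. if j \<in> insert f F then A i j + A i l * x j else A i j)"
    using insert by (auto simp: fun_eq_iff)
  finally show ?case .
qed

lemma elementary_equiv_collect_rows:
  assumes "finite F" "F \<subseteq> I" "k \<in> I" "k \<notin> F"
  shows "elementary_equiv I J A (A(k := \<lambda>j. A k j + (\<Sum>i\<in>F. x i * A i j)))"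
  using assms
proof induction
  case empty
  then show ?case
    by (simp add: elementary_equiv.refl)
next
  case (insert f F)
  let ?B = "A(k := \<lambda>j. A k j + (\<Sum>i\<in>F. x i * A i j))"
  have "elementary_equiv I J A ?B"
    using insert by (simp del: fun_upd_apply)
  then have "elementary_equiv I J A (?B(k := \<lambda>j. ?B k j + x f * ?B f j))"
    by (rule elementary_equiv.row) (use insert in auto)
  also have "?B(k := \<lambda>j. ?B k j + x f * ?B f j) =
      A(k := \<lambda>j. A k j + (\<Sum>i\<in>insert f F. x i * A i j))"
    using insert by (auto simp: fun_eq_iff add_ac)
  finally show ?case .
qed

section \<open>Pivoting and diagonal reduction\<close>

text \<open>The gcd construction multiplies the entries on the right, whereas row operations
  multiply on the left. The duo property converts each product A i l * y i into a left multiple of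
  the same entry.\<close>

lemma column_pivot:
  fixes A :: "nat \<Rightarrow> nat \<Rightarrow> 'a::ring_1"
  assumes bezout: "bezout_ring TYPE('a)" and sr: "stable_range_1 TYPE('a)"
    and duo: "\<And>a::'a. left_multiples a = right_multiples a"
    and I: "finite I" "k \<in> I"
  shows "\<exists>x. \<forall>i\<in>I. A i l \<in> right_multiples (A k l + (\<Sum>i\<in>I - {k}. x i * A i l))"
proof -
  obtain y where y: "insert (A k l) ((\<lambda>i. A i l) ` (I - {k}))
      \<subseteq> right_multiples (A k l + (\<Sum>i\<in>I - {k}. A i l * y i))"
    using right_gcd_elementary_sum[OF bezout sr, of "I - {k}" "A k l" "\<lambda>i. A i l"] I(1) by auto
  have "\<exists>x. A i l * y i = x * A i l" for i
    using duo[of "A i l"] by (metis left_multiples_iff right_multiples_iff)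
  then obtain x where x: "\<And>i. A i l * y i = x i * A i l"
    by metis
  show ?thesis
    using y unfolding x by blast
qed

text \<open>Induction on the columns. The entry d at (k, l') already divides the columns in
  \<open>insert l' J\<close>; one column operation followed by row operations into row
  \<open>k\<close> produces at (k, l) a generator for d and column \<open>l\<close>
  together.\<close>

lemma elementary_equiv_pivot:
  fixes A :: "nat \<Rightarrow> nat \<Rightarrow> 'a::ring_1"
  assumes bezout: "bezout_ring TYPE('a)" and sr: "stable_range_1 TYPE('a)"
    and duo: "\<And>a::'a. left_multiples a = right_multiples a"
    and I: "finite I" "k \<in> I" and J: "finite J" "l \<notin> J"
  shows "\<exists>B. elementary_equiv I (insert l J) A B \<and>
    (\<forall>i\<in>I. \<forall>j\<in>insert l J. B i j \<in> right_multiples (B k l))"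
  using J
proof (induction J arbitrary: l A)
  case empty
  obtain x where x: "\<And>i. i \<in> I \<Longrightarrow> A i l \<in> right_multiples (A k l + (\<Sum>i\<in>I - {k}. x i * A i l))"
    using column_pivot[OF bezout sr duo I, of A l] by blast
  let ?B = "A(k := \<lambda>j. A k j + (\<Sum>i\<in>I - {k}. x i * A i j))"
  have "elementary_equiv I (insert l {}) A ?B"
    using I by (intro elementary_equiv_collect_rows) auto
  moreover have "\<forall>i\<in>I. \<forall>j\<in>insert l {}. ?B i j \<in> right_multiples (?B k l)"
    using x by (simp add: self_in_right_multiples)
  ultimately show ?case
    by blast
next
  case (insert l' J)
  obtain B where AB: "elementary_equiv I (insert l' J) A B"
    and B: "\<And>i j. i \<in> I \<Longrightarrow> j \<in> insert l' J \<Longrightarrow> B i j \<in> right_multiples (B k l')"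
    using insert.IH[OF insert.hyps(2)] by blast
  let ?J = "insert l (insert l' J)" and ?F = "I - {k}"
  define d where "d = B k l'"
  have F: "finite ?F" "?F \<subseteq> I" "k \<notin> ?F"
    using I by auto
  have "\<exists>c. B i l' = c * d" if "i \<in> I" for i
    using B[OF that, of l'] duo[of d] unfolding d_def[symmetric]
    by (metis insertI1 left_multiples_iff)
  then obtain c where c: "\<And>i. i \<in> I \<Longrightarrow> B i l' = c i * d"
    by metis
  define C where "C = (\<lambda>i j. if i \<in> ?F then B i j + - c i * B k j else B i j)"
  have BC: "elementary_equiv I ?J B C"
    unfolding C_def by (rule elementary_equiv_add_to_rows[OF F(1,2) I(2) F(3)])
  have C: "C i j \<in> right_multiples d" if "i \<in> I" "j \<in> insert l' J" for i j
  proof -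
    have "left_ideal (right_multiples d)"
      using left_ideal_left_multiples[of d] duo by simp
    with B[OF that] B[OF I(2) that(2)]
    have "B i j + - c i * B k j \<in> right_multiples d"
      unfolding d_def[symmetric]
      by (intro right_ideal_addD[OF right_ideal_right_multiples] left_ideal_multD)
    with B[OF that] show ?thesis
      by (simp add: C_def d_def)
  qed
  have C0: "C i l' = 0" if "i \<in> ?F" for i
    using that c[of i] by (simp add: C_def d_def)
  have Ck: "C k l' = d"
    by (simp add: C_def d_def)
  obtain s where s: "C k l \<in> right_multiples (C k l + d * s)" "d \<in> right_multiples (C k l + d * s)"
    using right_gcd_elementary[OF bezout sr] .
  define D where "D = (\<lambda>i. (C i)(l := C i l + C i l' * s))"
  have CD: "elementary_equiv I ?J C D"
    unfolding D_def using insert.prems by (intro elementary_equiv.col elementary_equiv.refl) auto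
  obtain x where x: "\<And>i. i \<in> I \<Longrightarrow> D i l \<in> right_multiples (D k l + (\<Sum>i\<in>?F. x i * D i l))"
    using column_pivot[OF bezout sr duo I, of D l] by blast
  define g where "g = D k l + (\<Sum>i\<in>?F. x i * D i l)"
  define E where "E = D(k := \<lambda>j. D k j + (\<Sum>i\<in>?F. x i * D i j))"
  have DE: "elementary_equiv I ?J D E"
    unfolding E_def by (rule elementary_equiv_collect_rows[OF F(1,2) I(2) F(3)])
  have S: "right_ideal (right_multiples g)" "left_ideal (right_multiples g)"
    using right_ideal_right_multiples[of g] left_ideal_left_multiples[of g] duo by simp_all
  have "D k l = C k l + d * s"
    by (simp add: D_def Ck)
  \<comment> \<open>The chain is d in (D k l)R and D k l in gR. Columns other than \<open>l\<close>
    agree in C and D and have entries in dR, so they lie in gR as well.\<close>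
  then have "d \<in> right_multiples g"
    using s(2) right_multiples_subset[OF x[OF I(2)]] unfolding g_def by auto
  then have D: "D i j \<in> right_multiples g" if "i \<in> I" "j \<in> ?J" for i j
  proof (cases "j = l")
    case True
    then show ?thesis
      using x[OF that(1)] by (simp add: g_def)
  next
    case False
    then show ?thesis
      using C[of i j] that right_multiples_subset[OF \<open>d \<in> right_multiples g\<close>] by (auto simp: D_def)
  qed
  have "E i j \<in> right_multiples g" if "i \<in> I" "j \<in> ?J" for i j
    using D that I(2) S
    by (cases "i = k") (auto simp: E_def intro!: right_ideal_addD right_ideal_sum left_ideal_multD)
  moreover have "E k l = g"
    by (simp add: E_def g_def)
  moreover have "elementary_equiv I ?J A E"
    using elementary_equiv_mono[OF AB, of I ?J] BC CD DE by (blast intro: elementary_equiv_trans)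
  ultimately show ?case
    by auto
qed

text \<open>Recursion on the lower right block starting at (k, k): a pivot dividing the whole block
  is placed there, its row and column are cleared, and the next block is treated. Indexing by
  intervals keeps the original positions, so nothing is shifted.\<close>

lemma elementary_equiv_diagonal:
  fixes A :: "nat \<Rightarrow> nat \<Rightarrow> 'a::ring_1"
  assumes bezout: "bezout_ring TYPE('a)" and sr: "stable_range_1 TYPE('a)"
    and duo: "\<And>a::'a. left_multiples a = right_multiples a"
  shows "\<exists>B. elementary_equiv {k..<m} {k..<n} A B \<and>
    (\<forall>i\<in>{k..<m}. \<forall>j\<in>{k..<n}. i \<noteq> j \<longrightarrow> B i j = 0) \<and>
    (\<forall>i\<ge>k. Suc i < min m n \<longrightarrow> B (Suc i) (Suc i) \<in> right_multiples (B i i))"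
proof (induction "m - k" arbitrary: k A)
  case 0
  then show ?case
    by (auto intro: elementary_equiv.refl)
next
  case (Suc d)
  show ?case
  proof (cases "k < n")
    case False
    then show ?thesis
      by (auto intro: elementary_equiv.refl)
  next
    case True
    let ?I = "{k..<m}" and ?J = "{k..<n}" and ?I' = "{Suc k..<m}" and ?J' = "{Suc k..<n}"
    have k: "k \<in> ?I" "k \<in> ?J"
      using Suc.hyps(2) True by auto
    have J: "insert k ?J' = ?J"
      using True by auto
    obtain B where AB: "elementary_equiv ?I ?J A B"
      and B: "\<And>i j. i \<in> ?I \<Longrightarrow> j \<in> ?J \<Longrightarrow> B i j \<in> right_multiples (B k k)"
      using elementary_equiv_pivot[OF bezout sr duo _ k(1), of ?J' k A] unfolding J by auto
    define g where "g = B k k"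
    have S: "right_ideal (right_multiples g)" "left_ideal (right_multiples g)"
      using right_ideal_right_multiples[of g] left_ideal_left_multiples[of g] duo by simp_all
    \<comment> \<open>Row operations need quotients on the left, which the duo property supplies;
      the column operations use the right quotients \<open>e\<close> directly.\<close>
    have "\<exists>c. B i k = c * g" if "i \<in> ?I" for i
      using B[OF that k(2)] duo[of g] unfolding g_def[symmetric] by (metis left_multiples_iff)
    then obtain c where c: "\<And>i. i \<in> ?I \<Longrightarrow> B i k = c i * g"
      by metis
    have "\<exists>e. B k j = g * e" if "j \<in> ?J" for j
      using B[OF k(1) that] unfolding g_def[symmetric] by (metis right_multiples_iff)
    then obtain e where e: "\<And>j. j \<in> ?J \<Longrightarrow> B k j = g * e j"
      by metis
    define C where "C = (\<lambda>i j. if i \<in> ?I' then B i j + - c i * B k j else B i j)"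
    have BC: "elementary_equiv ?I ?J B C"
      unfolding C_def using k by (intro elementary_equiv_add_to_rows) auto
    define D where "D = (\<lambda>i j. if j \<in> ?J' then C i j + C i k * - e j else C i j)"
    have CD: "elementary_equiv ?I ?J C D"
      unfolding D_def using k by (intro elementary_equiv_add_to_cols) auto
    have AD: "elementary_equiv ?I ?J A D"
      using AB BC CD by (blast intro: elementary_equiv_trans)
    have C_col: "C i k = 0" if "i \<in> ?I'" for i
      using that c[of i] by (simp add: C_def g_def)
    have D_col: "D i k = 0" if "i \<in> ?I'" for i
      using C_col[OF that] by (simp add: D_def)
    have D_row: "D k j = 0" if "j \<in> ?J'" for j
      using that e[of j] by (simp add: D_def C_def g_def)
    have D_pivot: "D k k = g"
      by (simp add: D_def C_def g_def)
    have BD: "elementary_equiv ?I ?J B D"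
      using BC CD by (rule elementary_equiv_trans)
    have D: "D i j \<in> right_multiples g" if "i \<in> ?I'" "j \<in> ?J'" for i j
      using elementary_equiv_ideal[OF BD S, of i j] B that unfolding g_def by auto
    have "d = m - Suc k"
      using Suc.hyps(2) by simp
    from Suc.hyps(1)[OF this, of D]
    obtain G where DG: "elementary_equiv ?I' ?J' D G"
      and G0: "\<forall>i\<in>?I'. \<forall>j\<in>?J'. i \<noteq> j \<longrightarrow> G i j = 0"
      and G: "\<forall>i\<ge>Suc k. Suc i < min m n \<longrightarrow> G (Suc i) (Suc i) \<in> right_multiples (G i i)"
      by (elim exE conjE) (rule that)
    have "elementary_equiv ?I ?J A G"
      by (rule elementary_equiv_trans[OF AD elementary_equiv_mono[OF DG]]) auto
    moreover have "G i j = 0" if ij: "i \<in> ?I" "j \<in> ?J" "i \<noteq> j" for i j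
    proof -
      consider "i = k" "j \<in> ?J'" | "j = k" "i \<in> ?I'" | "i \<in> ?I'" "j \<in> ?J'"
        using ij by force
      then show ?thesis
      proof cases
        case 1
        then show ?thesis
          using elementary_equiv_row_zero[OF DG, of k j] D_row by simp
      next
        case 2
        then show ?thesis
          using elementary_equiv_col_zero[OF DG, of k i] D_col by simp
      next
        case 3
        then show ?thesis
          using G0 ij(3) by blast
      qed
    qed
    moreover have "G (Suc i) (Suc i) \<in> right_multiples (G i i)" if "k \<le> i" "Suc i < min m n" for i
    proof (cases "i = k")
      case True
      \<comment> \<open>The pivot lies outside the smaller block and is unchanged. The next diagonal
        entry stays in gR because gR is a two-sided ideal containing the block before the recursive
        operations.\<close>
      have "G k k = g"
        using elementary_equiv_outside[OF DG, of k k] D_pivot by simp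
      then show ?thesis
        using elementary_equiv_ideal[OF DG S D, of "Suc k" "Suc k"] that True by simp
    next
      case False
      then show ?thesis
        using G that by simp
    qed
    ultimately show ?thesis
      by blast
  qed
qed

section \<open>Realising the operations by invertible matrices\<close>

definition elementary_mat :: "nat \<Rightarrow> nat \<Rightarrow> nat \<Rightarrow> 'a::ring_1 \<Rightarrow> 'a mat" where
  "elementary_mat n i k x =
     mat n n (\<lambda>(a, b). (if a = b then 1 else 0) + (if a = i \<and> b = k then x else 0))"

lemma elementary_mat_carrier [simp]: "elementary_mat n i k x \<in> carrier_mat n n"
  by (simp add: elementary_mat_def)

text \<open>Each entry of \<open>elementary_mat\<close> is an identity entry plus a correction, so
  the scalar product splits into two sums with at most one nonzero term each.\<close>

lemma elementary_mat_mult_left: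
  assumes "X \<in> carrier_mat m n" "i < m" "k < m" "a < m" "j < n"
  shows "(elementary_mat m i k x * X) $$ (a, j) = X $$ (a, j) + (if a = i then x * X $$ (k, j) else 0)"
proof -
  have "(elementary_mat m i k x * X) $$ (a, j) =
      (\<Sum>b = 0..<m. (if a = b then X $$ (b, j) else 0) + (if b = k then if a = i then x * X $$ (b, j) else 0 else 0))"
    using assms by (auto simp: elementary_mat_def scalar_prod_def distrib_right intro!: sum.cong)
  also have "\<dots> = X $$ (a, j) + (if a = i then x * X $$ (k, j) else 0)"
    using assms by (simp add: sum.distrib)
  finally show ?thesis .
qed

lemma elementary_mat_mult_right:
  assumes "X \<in> carrier_mat m n" "l < n" "j < n" "i < m" "b < n"
  shows "(X * elementary_mat n l j x) $$ (i, b) = X $$ (i, b) + (if b = j then X $$ (i, l) * x else 0)"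
proof -
  have "(X * elementary_mat n l j x) $$ (i, b) =
      (\<Sum>a = 0..<n. (if a = b then X $$ (i, a) else 0) + (if a = l then if b = j then X $$ (i, a) * x else 0 else 0))"
    using assms by (auto simp: elementary_mat_def scalar_prod_def distrib_left intro!: sum.cong)
  also have "\<dots> = X $$ (i, b) + (if b = j then X $$ (i, l) * x else 0)"
    using assms by (simp add: sum.distrib)
  finally show ?thesis .
qed

lemma elementary_mat_inverse:
  assumes "i < n" "k < n" "i \<noteq> k"
  shows "elementary_mat n i k x * elementary_mat n i k (- x) = 1\<^sub>m n"
proof (rule eq_matI)
  fix a b assume ab: "a < dim_row (1\<^sub>m n)" "b < dim_col (1\<^sub>m n)"
  then have "a < n" "b < n"
    by simp_all
  then show "(elementary_mat n i k x * elementary_mat n i k (- x)) $$ (a, b) = 1\<^sub>m n $$ (a, b)"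
    using assms
    by (subst elementary_mat_mult_left[OF elementary_mat_carrier]) (auto simp: elementary_mat_def)
qed (simp_all add: elementary_mat_def)

lemma invertible_elementary_mat:
  assumes "i < n" "k < n" "i \<noteq> k"
  shows "invertible_mat (elementary_mat n i k x)"
proof -
  have "inverts_mat (elementary_mat n i k x) (elementary_mat n i k (- x))"
    "inverts_mat (elementary_mat n i k (- x)) (elementary_mat n i k x)"
    using elementary_mat_inverse[OF assms, of x] elementary_mat_inverse[OF assms, of "- x"]
    unfolding inverts_mat_def by (simp_all add: elementary_mat_def)
  moreover have "square_mat (elementary_mat n i k x)"
    by (simp add: elementary_mat_def)
  ultimately show ?thesis
    unfolding invertible_mat_def by blast
qed

lemma invertible_mat_mult:
  assumes "A \<in> carrier_mat n n" "B \<in> carrier_mat n n" "invertible_mat A" "invertible_mat B"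
  shows "invertible_mat (A * B)"
proof -
  obtain A' where A': "A' \<in> carrier_mat n n" "A * A' = 1\<^sub>m n" "A' * A = 1\<^sub>m n"
    using invertible_mat_obtain_inverse[OF assms(1,3)] .
  obtain B' where B': "B' \<in> carrier_mat n n" "B * B' = 1\<^sub>m n" "B' * B = 1\<^sub>m n"
    using invertible_mat_obtain_inverse[OF assms(2,4)] .
  have cancel: "(W * X) * (Y * Z) = 1\<^sub>m n"
    if "W \<in> carrier_mat n n" "X \<in> carrier_mat n n" "Y \<in> carrier_mat n n" "Z \<in> carrier_mat n n"
      "X * Y = 1\<^sub>m n" "W * Z = 1\<^sub>m n" for W X Y Z :: "'a mat"
  proof -
    have "(W * X) * (Y * Z) = W * (X * (Y * Z))"
      using that by (intro assoc_mult_mat[of _ n n _ n _ n]) auto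
    also have "X * (Y * Z) = X * Y * Z"
      using that by (intro assoc_mult_mat[of _ n n _ n _ n, symmetric]) auto
    also have "\<dots> = Z"
      using that(4) by (simp add: that(5))
    finally show ?thesis
      by (simp add: that(6))
  qed
  have "A * B * (B' * A') = 1\<^sub>m n" "B' * A' * (A * B) = 1\<^sub>m n"
    using cancel[OF assms(1,2) B'(1) A'(1) B'(2) A'(2)] cancel[OF B'(1) A'(1) assms(1,2) A'(3) B'(3)] .
  then have "inverts_mat (A * B) (B' * A')" "inverts_mat (B' * A') (A * B)"
    using assms(1) B'(1) by (simp_all add: inverts_mat_def)
  moreover have "square_mat (A * B)"
    using assms(1,2) by simp
  ultimately show ?thesis
    unfolding invertible_mat_def by blast
qed

lemma invertible_one_mat: "invertible_mat (1\<^sub>m n :: 'a::ring_1 mat)"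
  unfolding invertible_mat_def inverts_mat_def by (auto intro!: exI[of _ "1\<^sub>m n"])

text \<open>Row operations accumulate as left factors of P, column operations as right factors of
  Q.\<close>

lemma elementary_equiv_imp_mat:
  assumes "elementary_equiv {..<m} {..<n} A B"
  shows "\<exists>P\<in>carrier_mat m m. \<exists>Q\<in>carrier_mat n n. invertible_mat P \<and> invertible_mat Q \<and>
    P * mat m n (\<lambda>(i, j). A i j) * Q = mat m n (\<lambda>(i, j). B i j)"
  using assms
proof induction
  case refl
  show ?case
    by (intro bexI[of _ "1\<^sub>m m"] bexI[of _ "1\<^sub>m n"] conjI invertible_one_mat) simp_all
next
  case (row B i k x)
  let ?A = "mat m n (\<lambda>(i, j). A i j)" and ?B = "mat m n (\<lambda>(i, j). B i j)"
  obtain P Q where PQ: "P \<in> carrier_mat m m" "Q \<in> carrier_mat n n" "invertible_mat P" "invertible_mat Q"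
      "P * ?A * Q = ?B"
    using row.IH by blast
  let ?E = "elementary_mat m i k x"
  have E: "?E \<in> carrier_mat m m" "?A \<in> carrier_mat m n"
    by simp_all
  have ik: "i < m" "k < m" "i \<noteq> k"
    using row.hyps by simp_all
  have "?E * P * ?A * Q = ?E * (P * ?A) * Q"
    using assoc_mult_mat[OF E(1) PQ(1) E(2)] by simp
  also have "\<dots> = ?E * ?B"
    using assoc_mult_mat[OF E(1) mult_carrier_mat[OF PQ(1) E(2)] PQ(2)] PQ(5) by simp
  also have "\<dots> = mat m n (\<lambda>(a, j). (B(i := \<lambda>j. B i j + x * B k j)) a j)"
  proof (rule eq_matI)
    fix a j assume "a < dim_row (mat m n (\<lambda>(a, j). (B(i := \<lambda>j. B i j + x * B k j)) a j))"
      "j < dim_col (mat m n (\<lambda>(a, j). (B(i := \<lambda>j. B i j + x * B k j)) a j))"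
    then have "a < m" "j < n"
      by simp_all
    then show "(?E * ?B) $$ (a, j) = mat m n (\<lambda>(a, j). (B(i := \<lambda>j. B i j + x * B k j)) a j) $$ (a, j)"
      using ik by (simp add: elementary_mat_mult_left[of _ m n])
  qed (simp_all add: elementary_mat_def)
  finally have "?E * P * ?A * Q = mat m n (\<lambda>(a, j). (B(i := \<lambda>j. B i j + x * B k j)) a j)" .
  moreover have "invertible_mat (?E * P)"
    using invertible_mat_mult[OF E(1) PQ(1) invertible_elementary_mat[OF ik] PQ(3)] .
  ultimately show ?case
    using PQ(2,4) mult_carrier_mat[OF E(1) PQ(1)] by blast
next
  case (col B j l x)
  let ?A = "mat m n (\<lambda>(i, j). A i j)" and ?B = "mat m n (\<lambda>(i, j). B i j)"
  obtain P Q where PQ: "P \<in> carrier_mat m m" "Q \<in> carrier_mat n n" "invertible_mat P" "invertible_mat Q"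
      "P * ?A * Q = ?B"
    using col.IH by blast
  \<comment> \<open>The indices are swapped compared with the row case: multiplication on the right
    adds column \<open>l\<close> times \<open>x\<close> to column \<open>j\<close>.\<close>
  let ?E = "elementary_mat n l j x"
  have E: "?E \<in> carrier_mat n n" "?A \<in> carrier_mat m n"
    by simp_all
  have lj: "l < n" "j < n" "l \<noteq> j"
    using col.hyps by auto
  have "P * ?A * (Q * ?E) = ?B * ?E"
    using assoc_mult_mat[OF mult_carrier_mat[OF PQ(1) E(2)] PQ(2) E(1)] PQ(5) by simp
  also have "\<dots> = mat m n (\<lambda>(i, b). ((B i)(j := B i j + B i l * x)) b)"
  proof (rule eq_matI)
    fix i b assume "i < dim_row (mat m n (\<lambda>(i, b). ((B i)(j := B i j + B i l * x)) b))"
      "b < dim_col (mat m n (\<lambda>(i, b). ((B i)(j := B i j + B i l * x)) b))"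
    then have "i < m" "b < n"
      by simp_all
    then show "(?B * ?E) $$ (i, b) = mat m n (\<lambda>(i, b). ((B i)(j := B i j + B i l * x)) b) $$ (i, b)"
      using lj by (simp add: elementary_mat_mult_right[of _ m n])
  qed (simp_all add: elementary_mat_def)
  finally have "P * ?A * (Q * ?E) = mat m n (\<lambda>(i, b). ((B i)(j := B i j + B i l * x)) b)" .
  moreover have "invertible_mat (Q * ?E)"
    using invertible_mat_mult[OF PQ(2) E(1) PQ(4) invertible_elementary_mat[OF lj]] .
  ultimately show ?case
    using PQ(1,3) mult_carrier_mat[OF PQ(2) E(1)] by blast
qed

lemma duo_ring_imp_elementary_divisor_ring:
  assumes bezout: "bezout_ring TYPE('a::ring_1)" and sr: "stable_range_1 TYPE('a)"
    and duo_ring: "duo_ring TYPE('a)"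
  shows "elementary_divisor_ring TYPE('a)"
  unfolding elementary_divisor_ring_def
proof (intro allI ballI)
  fix m n and A :: "'a mat" assume A: "A \<in> carrier_mat m n"
  have duo: "left_multiples a = right_multiples a" for a :: 'a
    using duo_ring by (simp add: duo_ring_iff)
  define f where "f = (\<lambda>i j. A $$ (i, j))"
  have A_f: "mat m n (\<lambda>(i, j). f i j) = A"
    using A by (intro eq_matI) (auto simp: f_def)
  have "\<exists>g. elementary_equiv {..<m} {..<n} f g \<and>
      (\<forall>i\<in>{..<m}. \<forall>j\<in>{..<n}. i \<noteq> j \<longrightarrow> g i j = 0) \<and>
      (\<forall>i\<ge>0. Suc i < min m n \<longrightarrow> g (Suc i) (Suc i) \<in> right_multiples (g i i))"
    using elementary_equiv_diagonal[OF bezout sr duo, of 0 m n f] unfolding lessThan_atLeast0 .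
  then obtain g where g: "elementary_equiv {..<m} {..<n} f g"
      and diag: "\<forall>i\<in>{..<m}. \<forall>j\<in>{..<n}. i \<noteq> j \<longrightarrow> g i j = 0"
      and chain: "\<forall>i\<ge>0. Suc i < min m n \<longrightarrow> g (Suc i) (Suc i) \<in> right_multiples (g i i)"
    by (elim exE conjE) (rule that)
  define D where "D = mat m n (\<lambda>(i, j). g i j)"
  obtain P Q where PQ: "P \<in> carrier_mat m m" "Q \<in> carrier_mat n n" "invertible_mat P" "invertible_mat Q"
      "P * A * Q = D"
    using elementary_equiv_imp_mat[OF g] unfolding A_f D_def by blast
  have "diagonal_mat D"
    using diag by (simp add: D_def diagonal_mat_def)
  moreover have "two_sided_ideal hull {D $$ (Suc i, Suc i)}
      \<subseteq> left_multiples (D $$ (i, i)) \<inter> right_multiples (D $$ (i, i))" if i: "Suc i < min m n" for i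
  proof -
    \<comment> \<open>Over a duo ring gR is two-sided and equals Rg, so divisibility of consecutive
      diagonal entries already bounds the generated two-sided ideal on both sides.\<close>
    have "two_sided_ideal (right_multiples (g i i))"
      using right_ideal_right_multiples[of "g i i"] left_ideal_left_multiples[of "g i i"] duo
      by (simp add: two_sided_ideal_def)
    then have "two_sided_ideal hull {g (Suc i) (Suc i)} \<subseteq> right_multiples (g i i)"
      using chain i by (intro hull_minimal) auto
    then show ?thesis
      using i duo by (simp add: D_def)
  qed
  moreover have "D \<in> carrier_mat m n"
    by (simp add: D_def)
  ultimately show "\<exists>P\<in>carrier_mat m m. \<exists>Q\<in>carrier_mat n n. \<exists>D\<in>carrier_mat m n.
      invertible_mat P \<and> invertible_mat Q \<and> P * A * Q = D \<and> diagonal_mat D \<and>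
      (\<forall>i. Suc i < min m n \<longrightarrow> two_sided_ideal hull {D $$ (Suc i, Suc i)}
        \<subseteq> left_multiples (D $$ (i, i)) \<inter> right_multiples (D $$ (i, i)))"
    using PQ by blast
qed

theorem theorem2:
  assumes "bezout_ring TYPE('a::ring_1)"
    and "stable_range_1 TYPE('a)"
    and "kazimirsky TYPE('a)"
  shows "elementary_divisor_ring TYPE('a) \<longleftrightarrow> duo_ring TYPE('a)"
  using elementary_divisor_ring_imp_duo_ring[OF assms(2,3)]
    duo_ring_imp_elementary_divisor_ring[OF assms(1,2)]
  by blast

end
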